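(* Let $\rho:[0,+\infty)\to\mathbb{R}$ satisfy: (AS1) $\rho(0)=0$, $\rho(s)<+\infty$ for all $s<+\infty$, and $0$ is the strict minimizer of $\rho$; (AS2) $\rho$ is increasing on $[0,+\infty)$. Let $\tau\in(0,+\infty]$ and $\mathcal{T}(s)=\rho(\min(s,\tau))$ for $s\ge0$ (so $\mathcal{T}=\rho$ if $\tau=+\infty$), and assume $\mathcal{T}$ is subadditive: $\mathcal{T}(a+b)\le\mathcal{T}(a)+\mathcal{T}(b)$ for all $a,b\ge0$. Let $J=\{1,\dots,N\}$, $\emptyset\ne\Omega\subsetneq J$, let $\mathbf{1}_\Omega\in\mathbb{R}^N$ be the indicator function of $\Omega$, and let $J_1=\{i\in J:(\nabla_x\mathbf{1}_\Omega)_i\ne0\}$. Let $\alpha>0$, $\zeta>0$, and let $A$ be a real $K\times N$ matrix with $A^{\mathsf T}A=\mathrm{diag}\{d_1,\dots,d_N\}$, $d_i>0$ for $i=1,\dots,N$. Let $v$ be a global minimizer over $\mathbb{R}^N$ of $$E^\zeta(u)=\sum_{1\le i\le N}\mathcal{T}(|(\nabla_x u)_i|)+\frac{\alpha}{2}\|A(u-\zeta\mathbf{1}_\Omega)\|_{\mathbb{R}^K}^2.$$ Then: (1) the extremum principle holds, i.e., $0\le v_i\le\zeta$ for all $i\in J$; (2) no new discontinuity appears in $v$, i.e., $\{i\in J:(\nabla_x v)_i\ne0\}\subseteq J_1$; (3) $v$ preserves the monotonicity (not necessarily strict) of the input signal $\zeta\mathbf{1}_\Omega$: for neighbouring indices $j,j+1$,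 $(\zeta\mathbf{1}_\Omega)_j\le(\zeta\mathbf{1}_\Omega)_{j+1}$ implies $v_j\le v_{j+1}$, and $(\zeta\mathbf{1}_\Omega)_j\ge(\zeta\mathbf{1}_\Omega)_{j+1}$ implies $v_j\ge v_{j+1}$.
   Context: "Increasing" is meant in the non-strict sense. $\nabla_x$ is the forward difference operator, $(\nabla_x u)_i=u_{i+1}-u_i$ for $1\le i\le N-1$, with a boundary condition at $i=N$, e.g. periodic ($(\nabla_x u)_N=u_1-u_N$, with indices read modulo $N$) or Neumann ($(\nabla_x u)_N=0$). $\|\cdot\|_{\mathbb{R}^K}$ is the Euclidean norm. *)

theory Defs
  imports
    "Jordan_Normal_Form.Matrix"
    "HOL-Analysis.L2_Norm"
    "HOL-Library.Extended_Real"
    "HOL-Library.Indicator_Function"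
begin

text \<open>Vectors and matrices are those of \<^theory>\<open>Jordan_Normal_Form.Matrix\<close>, so they are indexed
  from 0: the index set \<open>J = {1, ..., N}\<close> becomes \<open>{..<N}\<close>.\<close>

datatype boundary = Periodic | Neumann

definition fwd_diff :: "boundary \<Rightarrow> real vec \<Rightarrow> real vec" where
  "fwd_diff bc u = vec (dim_vec u) (\<lambda>i.
     if Suc i < dim_vec u then u $ Suc i - u $ i
     else (case bc of Periodic \<Rightarrow> u $ 0 - u $ i | Neumann \<Rightarrow> 0))"

definition jump_set :: "boundary \<Rightarrow> real vec \<Rightarrow> nat set" where
  "jump_set bc u = {i. i < dim_vec u \<and> fwd_diff bc u $ i \<noteq> 0}"

text \<open>\<open>k\<close> is the index \<open>j + 1\<close>; in the periodic case indices are read modulo \<open>N\<close>, so that the last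
  index is followed by the first one.\<close>

definition next_index :: "boundary \<Rightarrow> nat \<Rightarrow> nat \<Rightarrow> nat \<Rightarrow> bool" where
  "next_index bc N j k \<longleftrightarrow>
     (k = Suc j \<and> Suc j < N) \<or> (bc = Periodic \<and> Suc j = N \<and> k = 0)"

definition indicator_vec :: "nat \<Rightarrow> nat set \<Rightarrow> real vec" where
  "indicator_vec N \<Omega> = vec N (indicator \<Omega>)"

text \<open>Meant for \<open>s \<ge> 0\<close> and \<open>\<tau> > 0\<close>, where the minimum is finite even if \<open>\<tau> = \<infinity>\<close>.\<close>

definition truncated :: "(real \<Rightarrow> real) \<Rightarrow> ereal \<Rightarrow> real \<Rightarrow> real" where
  "truncated \<rho> \<tau> s = \<rho> (real_of_ereal (min (ereal s) \<tau>))"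

definition euclid_norm :: "real vec \<Rightarrow> real" where
  "euclid_norm w = L2_set (\<lambda>k. w $ k) {..<dim_vec w}"

definition energy ::
  "boundary \<Rightarrow> (real \<Rightarrow> real) \<Rightarrow> real \<Rightarrow> real mat \<Rightarrow> real vec \<Rightarrow> real vec \<Rightarrow> real" where
  "energy bc T \<alpha> A f u =
     (\<Sum>i<dim_vec u. T \<bar>fwd_diff bc u $ i\<bar>) + \<alpha> / 2 * (euclid_norm (A *\<^sub>v (u - f)))\<^sup>2"

end

theory Submission
  imports Defs
begin

text \<open>Since \<open>A\<^sup>T A\<close> is diagonal, the fidelity term is a weighted sum of squares, so it
  decreases whenever single entries are moved towards the data. Clipping \<open>v\<close> to \<open>[0, \<zeta>]\<close>
  shortens all jumps and hence gives the extremum principle. For the other two claims, let \<open>j\<close> and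
  \<open>k\<close> be neighbours and overwrite \<open>v\<^sub>j\<close> with \<open>v\<^sub>k\<close>. The jump between \<open>j\<close> and \<open>k\<close> disappears, and as
  \<open>j\<close> has at most one other neighbour, subadditivity shows that the regulariser does not grow.
  By minimality \<open>v\<^sub>k\<close> is not closer than \<open>v\<^sub>j\<close> to the datum at \<open>j\<close>; the data being the extreme values
  0 and \<open>\<zeta>\<close>, this determines the order of \<open>v\<^sub>j\<close> and \<open>v\<^sub>k\<close>.\<close>

text \<open>At the Neumann end the successor is the index itself, so that the difference there vanishes.\<close>

definition succ_index :: "boundary \<Rightarrow> nat \<Rightarrow> nat \<Rightarrow> nat" where
  "succ_index bc N i =
     (if Suc i < N then Suc i else (case bc of Periodic \<Rightarrow> 0 | Neumann \<Rightarrow> i))"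

lemma succ_index_less: "i < N \<Longrightarrow> succ_index bc N i < N"
  by (cases bc) (auto simp: succ_index_def)

text \<open>At the Neumann end the last index is the successor both of itself and of its
  predecessor. This is the only collision, and excluding fixed points removes it.\<close>

lemma succ_index_inj:
  assumes "i < N" "j < N" "succ_index bc N i = succ_index bc N j"
    and "succ_index bc N i \<noteq> i" "succ_index bc N j \<noteq> j"
  shows "i = j"
  using assms by (cases bc) (auto simp: succ_index_def split: if_splits)

lemma next_index_succ_index: "next_index bc N j k \<Longrightarrow> j < N \<and> k = succ_index bc N j"
  by (auto simp: next_index_def succ_index_def)

lemma fwd_diff_index:
  "i < dim_vec u \<Longrightarrow> fwd_diff bc u $ i = u $ succ_index bc (dim_vec u) i - u $ i"
  by (cases bc) (auto simp: fwd_diff_def succ_index_def)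

lemma truncated_mono:
  assumes "mono_on {0..} \<rho>" "\<tau> > 0" "0 \<le> a" "a \<le> b"
  shows "truncated \<rho> \<tau> a \<le> truncated \<rho> \<tau> b"
proof -
  have "0 \<le> real_of_ereal (min (ereal a) \<tau>)"
    using assms by (intro real_of_ereal_pos) auto
  moreover have "real_of_ereal (min (ereal a) \<tau>) \<le> real_of_ereal (min (ereal b) \<tau>)"
    using assms by (cases \<tau>) (auto simp: min_def)
  ultimately show ?thesis
    unfolding truncated_def using assms(1) by (intro mono_onD[OF assms(1)]) auto
qed

lemma truncated_0: "\<tau> > 0 \<Longrightarrow> truncated \<rho> \<tau> 0 = \<rho> 0"
  by (simp add: truncated_def min_def zero_ereal_def[symmetric] less_imp_le)

text \<open>Bookkeeping for overwriting an entry: \<open>e\<close> is the jump that disappears, and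
  \<open>e'\<close> is the only other term that may grow, by at most the amount freed.\<close>

lemma sum_le_if_one_term_absorbed:
  fixes g g' :: "'a \<Rightarrow> real"
  assumes "finite I" "e \<in> I" "g' e = 0" "e' \<noteq> e" "0 \<le> g e"
    and le: "\<And>i. i \<in> I \<Longrightarrow> i \<noteq> e \<Longrightarrow> g' i \<le> g i + (if i = e' then g e else 0)"
  shows "sum g' I \<le> sum g I"
proof -
  have "sum g' I = sum g' (I - {e})"
    using assms by (simp add: sum.remove)
  also have "\<dots> \<le> (\<Sum>i\<in>I - {e}. g i + (if i = e' then g e else 0))"
    using le by (intro sum_mono) auto
  also have "\<dots> \<le> sum g (I - {e}) + g e"
    using assms by (simp add: sum.distrib)
  also have "\<dots> = sum g I"
    using assms by (simp add: sum.remove)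
  finally show ?thesis .
qed

text \<open>A difference is stored at the first of its two indices. Hence the jump that disappears
  is term \<open>j\<close> if \<open>k\<close> follows \<open>j\<close>, and term \<open>k\<close>
  if \<open>j\<close> follows \<open>k\<close>. It is absorbed by the jump on the other side of
  \<open>j\<close>: the term of the predecessor of \<open>j\<close>, or term \<open>j\<close>
  itself.\<close>

lemma sum_jumps_overwrite_le:
  fixes T :: "real \<Rightarrow> real" and v :: "nat \<Rightarrow> real"
  assumes T0: "T 0 = 0"
    and mono: "\<And>a b. 0 \<le> a \<Longrightarrow> a \<le> b \<Longrightarrow> T a \<le> T b"
    and subadd: "\<And>a b. 0 \<le> a \<Longrightarrow> 0 \<le> b \<Longrightarrow> T (a + b) \<le> T a + T b"
    and "j < N" "k < N" "j \<noteq> k"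
    and adj: "k = succ_index bc N j \<or> j = succ_index bc N k"
  shows "(\<Sum>i<N. T \<bar>(v(j := v k)) (succ_index bc N i) - (v(j := v k)) i\<bar>)
    \<le> (\<Sum>i<N. T \<bar>v (succ_index bc N i) - v i\<bar>)"
proof -
  let ?s = "succ_index bc N" and ?w = "v(j := v k)"
  have pos: "0 \<le> T \<bar>x\<bar>" for x
    using mono[of 0 "\<bar>x\<bar>"] T0 by simp
  have tri: "T \<bar>x - z\<bar> \<le> T \<bar>x - y\<bar> + T \<bar>y - z\<bar>" for x y z
    using mono[of "\<bar>x - z\<bar>" "\<bar>x - y\<bar> + \<bar>y - z\<bar>"] subadd[of "\<bar>x - y\<bar>" "\<bar>y - z\<bar>"]
    by linarith
  show ?thesis
    using adj
  proof
    assume k: "k = ?s j"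
    obtain l where l: "l \<noteq> j" "\<And>i. i < N \<Longrightarrow> i \<noteq> j \<Longrightarrow> ?s i = j \<Longrightarrow> i = l"
    proof (cases "\<exists>l<N. l \<noteq> j \<and> ?s l = j")
      case True
      then obtain l where l: "l < N" "l \<noteq> j" "?s l = j" by blast
      have "i = l" if "i < N" "i \<noteq> j" "?s i = j" for i
        by (rule succ_index_inj[of i N l bc])
          (simp_all add: l that l(2)[symmetric] that(2)[symmetric])
      with l(2) show ?thesis by (rule that)
    next
      case False
      \<comment> \<open>Here \<open>j\<close> is the first index under Neumann conditions and has no
        predecessor; \<open>k\<close> is a dummy, chosen only because it differs from
        \<open>j\<close>.\<close>
      with \<open>j \<noteq> k\<close> show ?thesis by (intro that[of k]) blast+
    qed
    show ?thesis
    proof (rule sum_le_if_one_term_absorbed[where e = j and e' = l])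
      fix i assume i: "i \<in> {..<N}" "i \<noteq> j"
      show "T \<bar>?w (?s i) - ?w i\<bar>
        \<le> T \<bar>v (?s i) - v i\<bar> + (if i = l then T \<bar>v (?s j) - v j\<bar> else 0)"
      proof (cases "?s i = j")
        case True
        then have "i = l" using i l(2)[of i] by simp
        \<comment> \<open>The jump at \<open>l\<close> now leads to \<open>v k\<close>; it is split
          at the old value \<open>v j\<close>.\<close>
        then show ?thesis using True i tri[of "v k" "v i" "v j"] by (simp add: k[symmetric])
      next
        case False
        then show ?thesis using i pos[of "v k - v j"] by (simp add: k[symmetric])
      qed
    qed (use \<open>j \<noteq> k\<close> \<open>j < N\<close> l(1) pos T0 in \<open>simp_all add: k[symmetric]\<close>)
  next
    assume j: "j = ?s k"
    show ?thesis
    proof (rule sum_le_if_one_term_absorbed[where e = k and e' = j])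
      fix i assume i: "i \<in> {..<N}" "i \<noteq> k"
      show "T \<bar>?w (?s i) - ?w i\<bar>
        \<le> T \<bar>v (?s i) - v i\<bar> + (if i = j then T \<bar>v (?s k) - v k\<bar> else 0)"
      proof (cases "i = j")
        case True
        \<comment> \<open>Again the split is at the old value \<open>v j\<close>. At the Neumann end
          \<open>?s j = j\<close>, the new difference is 0, and \<open>pos\<close> with
          \<open>T0\<close> suffices.\<close>
        then show ?thesis
          using tri[of "v (?s j)" "v k" "v j"] pos[of "v j - v k"] pos[of "v (?s j) - v j"] T0
          by (simp add: j[symmetric] abs_minus_commute)
      next
        case False
        \<comment> \<open>Apart from \<open>j\<close> itself at the Neumann end, only
          \<open>k\<close> precedes \<open>j\<close>, so this difference involves no overwritten
          entry.\<close>
        moreover have "?s i \<noteq> j"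
        proof
          assume "?s i = j"
          then have "i = k"
            using i False \<open>k < N\<close> \<open>j \<noteq> k\<close> j by (intro succ_index_inj[of i N k bc]) simp_all
          with i show False by simp
        qed
        ultimately show ?thesis by simp
      qed
    qed (use \<open>j \<noteq> k\<close> \<open>k < N\<close> pos T0 in \<open>simp_all add: j[symmetric]\<close>)
  qed
qed

text \<open>Moving one factor \<open>A\<close> across the inner product turns the squared norm into
  the quadratic form of the diagonal matrix.\<close>

lemma euclid_norm_mult_mat_vec:
  assumes A: "A \<in> carrier_mat K N" "transpose_mat A * A = mat_diag N d"
    and w: "w \<in> carrier_vec N"
  shows "(euclid_norm (A *\<^sub>v w))\<^sup>2 = (\<Sum>i<N. d i * (w $ i)\<^sup>2)"
proof -
  have diag: "(mat_diag N d *\<^sub>v w) $ i = d i * w $ i" if "i < N" for i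
  proof -
    have "(mat_diag N d *\<^sub>v w) $ i = (\<Sum>j<N. (if i = j then d j else 0) * w $ j)"
      using that w by (simp add: mat_diag_def scalar_prod_def atLeast0LessThan)
    also have "\<dots> = (\<Sum>j<N. if i = j then d j * w $ j else 0)"
      by (intro sum.cong) auto
    finally show ?thesis using that by simp
  qed
  have "(euclid_norm (A *\<^sub>v w))\<^sup>2 = (A *\<^sub>v w) \<bullet> (A *\<^sub>v w)"
    unfolding euclid_norm_def L2_set_def scalar_prod_def
    by (simp add: sum_nonneg power2_eq_square atLeast0LessThan)
  also have "\<dots> = (transpose_mat A *\<^sub>v (A *\<^sub>v w)) \<bullet> w"
    using A w by (subst transpose_vec_mult_scalar[of A K N]) auto
  also have "transpose_mat A *\<^sub>v (A *\<^sub>v w) = mat_diag N d *\<^sub>v w"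
    using A w by (subst assoc_mult_mat_vec[symmetric, of _ N K _ N]) auto
  also have "\<dots> \<bullet> w = (\<Sum>i<N. d i * (w $ i)\<^sup>2)"
    unfolding scalar_prod_def using w diag
    by (auto simp: atLeast0LessThan power2_eq_square mult_ac intro!: sum.cong)
  finally show ?thesis .
qed

lemma energy_diag:
  assumes A: "A \<in> carrier_mat K N" "transpose_mat A * A = mat_diag N d"
    and f: "f \<in> carrier_vec N"
  shows "energy bc T \<alpha> A f (vec N u) =
    (\<Sum>i<N. T \<bar>u (succ_index bc N i) - u i\<bar>) + \<alpha> / 2 * (\<Sum>i<N. d i * (u i - f $ i)\<^sup>2)"
proof -
  have "(euclid_norm (A *\<^sub>v (vec N u - f)))\<^sup>2 = (\<Sum>i<N. d i * ((vec N u - f) $ i)\<^sup>2)"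
    using f by (intro euclid_norm_mult_mat_vec[OF A]) auto
  then show ?thesis
    using f by (auto simp: energy_def fwd_diff_index succ_index_less)
qed

text \<open>Both competitors, clipped and overwritten, enter through this lemma. As all weights
  \<open>d i\<close> are positive, a strict gain at one index would make the energy of
  \<open>w\<close> strictly smaller than that of \<open>v\<close>.\<close>

lemma fidelity_minimizer:
  fixes \<alpha> :: real
  assumes A: "A \<in> carrier_mat K N" "transpose_mat A * A = mat_diag N d"
    and d: "\<And>i. i < N \<Longrightarrow> d i > 0" and "\<alpha> > 0" and f: "f \<in> carrier_vec N"
    and min: "is_arg_min (energy bc T \<alpha> A f) (\<lambda>u. u \<in> carrier_vec N) v"
    and reg: "(\<Sum>i<N. T \<bar>w (succ_index bc N i) - w i\<bar>)
      \<le> (\<Sum>i<N. T \<bar>v $ succ_index bc N i - v $ i\<bar>)"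
    and fid: "\<And>i. i < N \<Longrightarrow> \<bar>w i - f $ i\<bar> \<le> \<bar>v $ i - f $ i\<bar>"
    and j: "j < N"
  shows "\<bar>w j - f $ j\<bar> = \<bar>v $ j - f $ j\<bar>"
proof (rule ccontr)
  assume "\<bar>w j - f $ j\<bar> \<noteq> \<bar>v $ j - f $ j\<bar>"
  then have lt: "\<bar>w j - f $ j\<bar> < \<bar>v $ j - f $ j\<bar>" using fid[OF j] by simp
  have "v \<in> carrier_vec N" using min by (simp add: is_arg_min_def)
  then have v: "v = vec N (($) v)" by auto
  have "(\<Sum>i<N. d i * (w i - f $ i)\<^sup>2) < (\<Sum>i<N. d i * (v $ i - f $ i)\<^sup>2)"
  proof (rule sum_strict_mono_ex1)
    show "\<forall>i\<in>{..<N}. d i * (w i - f $ i)\<^sup>2 \<le> d i * (v $ i - f $ i)\<^sup>2"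
      using d fid by (auto intro!: mult_left_mono simp: abs_le_square_iff less_imp_le)
    have "(w j - f $ j)\<^sup>2 < (v $ j - f $ j)\<^sup>2"
      using lt power_strict_mono[of "\<bar>w j - f $ j\<bar>" "\<bar>v $ j - f $ j\<bar>" 2] by simp
    then show "\<exists>i\<in>{..<N}. d i * (w i - f $ i)\<^sup>2 < d i * (v $ i - f $ i)\<^sup>2"
      using d j by auto
  qed simp
  then have "energy bc T \<alpha> A f (vec N w) < energy bc T \<alpha> A f (vec N (($) v))"
    unfolding energy_diag[OF A f] using reg \<open>\<alpha> > 0\<close> by (intro add_le_less_mono) auto
  then have "energy bc T \<alpha> A f (vec N w) < energy bc T \<alpha> A f v"
    using v by simp
  then show False using min by (auto simp: is_arg_min_def)
qed

theorem theorem6p3: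
  fixes \<rho> :: "real \<Rightarrow> real" and \<tau> :: ereal and bc :: boundary
    and N K :: nat and \<Omega> :: "nat set" and \<alpha> \<zeta> :: real
    and A :: "real mat" and d :: "nat \<Rightarrow> real" and v :: "real vec"
  assumes AS1: "\<rho> 0 = 0" "\<And>s. s > 0 \<Longrightarrow> \<rho> 0 < \<rho> s"
    and AS2: "mono_on {0..} \<rho>"
    and tau: "\<tau> > 0"
    and subadditive: "\<And>a b. a \<ge> 0 \<Longrightarrow> b \<ge> 0 \<Longrightarrow>
      truncated \<rho> \<tau> (a + b) \<le> truncated \<rho> \<tau> a + truncated \<rho> \<tau> b"
    and Omega: "\<Omega> \<noteq> {}" "\<Omega> \<subset> {..<N}"
    and params: "\<alpha> > 0" "\<zeta> > 0"
    and A: "A \<in> carrier_mat K N" "transpose_mat A * A = mat_diag N d"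
    and d: "\<And>i. i < N \<Longrightarrow> d i > 0"
    and minimizer: "is_arg_min
      (energy bc (truncated \<rho> \<tau>) \<alpha> A (\<zeta> \<cdot>\<^sub>v indicator_vec N \<Omega>))
      (\<lambda>u. u \<in> carrier_vec N) v"
  shows "(\<forall>i<N. 0 \<le> v $ i \<and> v $ i \<le> \<zeta>)
    \<and> jump_set bc v \<subseteq> jump_set bc (indicator_vec N \<Omega>)
    \<and> (\<forall>j k. next_index bc N j k \<longrightarrow>
        ((\<zeta> \<cdot>\<^sub>v indicator_vec N \<Omega>) $ j \<le> (\<zeta> \<cdot>\<^sub>v indicator_vec N \<Omega>) $ k \<longrightarrow> v $ j \<le> v $ k)
      \<and> ((\<zeta> \<cdot>\<^sub>v indicator_vec N \<Omega>) $ j \<ge> (\<zeta> \<cdot>\<^sub>v indicator_vec N \<Omega>) $ k \<longrightarrow> v $ j \<ge> v $ k))"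
proof -
  let ?T = "truncated \<rho> \<tau>" and ?s = "succ_index bc N"
  define f where "f = \<zeta> \<cdot>\<^sub>v indicator_vec N \<Omega>"
  have f: "f \<in> carrier_vec N" by (simp add: f_def indicator_vec_def)
  have f_index: "f $ i = (if i \<in> \<Omega> then \<zeta> else 0)" if "i < N" for i
    using that by (simp add: f_def indicator_vec_def)
  have dim: "dim_vec v = N" using minimizer by (simp add: is_arg_min_def)
  note opt = fidelity_minimizer[OF A d params(1) f minimizer[folded f_def]]
  note mono = truncated_mono[OF AS2 tau]
  have T0: "?T 0 = 0" using truncated_0[OF tau] AS1 by simp

  define c where "c x = max 0 (min \<zeta> x)" for x
  have c: "0 \<le> v $ i \<and> v $ i \<le> \<zeta>" if "i < N" for i
  proof -
    have "\<bar>c (v $ i) - f $ i\<bar> = \<bar>v $ i - f $ i\<bar>"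
    proof (rule opt[where w = "\<lambda>i. c (v $ i)"])
      show "(\<Sum>i<N. ?T \<bar>c (v $ ?s i) - c (v $ i)\<bar>) \<le> (\<Sum>i<N. ?T \<bar>v $ ?s i - v $ i\<bar>)"
        by (intro sum_mono mono) (auto simp: c_def)
    qed (use that params in \<open>auto simp: c_def f_index\<close>)
    \<comment> \<open>The datum lies in the interval from 0 to \<open>\<zeta>\<close>, so clipping a
      value outside it would bring that value strictly closer to the datum.\<close>
    then show ?thesis
      using that params by (auto simp: c_def f_index max_def min_def split: if_splits)
  qed

  have adj: "\<bar>v $ j - f $ j\<bar> \<le> \<bar>v $ k - f $ j\<bar>"
    if "j < N" "k < N" "k = ?s j \<or> j = ?s k" for j k
  \<comment> \<open>The negated claim is what makes overwriting admissible for \<open>opt\<close>: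
    the entry at \<open>j\<close> gets closer to its datum, the others stay. It also rules out
    \<open>j = k\<close>, hence the fixed point at the Neumann end.\<close>
  proof (rule ccontr)
    assume less: "\<not> ?thesis"
    then have "j \<noteq> k" by auto
    have "\<bar>((($) v)(j := v $ k)) j - f $ j\<bar> = \<bar>v $ j - f $ j\<bar>"
    proof (rule opt[where w = "(($) v)(j := v $ k)"])
      show "(\<Sum>i<N. ?T \<bar>((($) v)(j := v $ k)) (?s i) - ((($) v)(j := v $ k)) i\<bar>)
        \<le> (\<Sum>i<N. ?T \<bar>v $ ?s i - v $ i\<bar>)"
        by (rule sum_jumps_overwrite_le[where v = "($) v",
              OF T0 mono subadditive that(1,2) \<open>j \<noteq> k\<close> that(3)])
    qed (use less \<open>j < N\<close> in auto)
    with less show False by simp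
  qed

  have jump: "(f $ j \<le> f $ k \<longrightarrow> v $ j \<le> v $ k) \<and> (f $ j \<ge> f $ k \<longrightarrow> v $ j \<ge> v $ k)"
    if "j < N" "k = ?s j" for j k
  proof -
    have "k < N" using that succ_index_less by simp
    \<comment> \<open>By the extremum principle the distance of \<open>x\<close> to the datum is
      \<open>x\<close> or \<open>\<zeta> - x\<close>. For equal data the two inequalities are
      opposite and force equality; for different data both express the order of the data.\<close>
    have "\<bar>v $ j - f $ j\<bar> \<le> \<bar>v $ k - f $ j\<bar>" "\<bar>v $ k - f $ k\<bar> \<le> \<bar>v $ j - f $ k\<bar>"
      using adj \<open>j < N\<close> \<open>k < N\<close> \<open>k = ?s j\<close> by blast+
    then show ?thesis
      using c[OF \<open>j < N\<close>] c[OF \<open>k < N\<close>] params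
      unfolding f_index[OF \<open>j < N\<close>] f_index[OF \<open>k < N\<close>]
      by (cases "j \<in> \<Omega>"; cases "k \<in> \<Omega>") simp_all
  qed
  have "jump_set bc v \<subseteq> jump_set bc (indicator_vec N \<Omega>)"
  proof
    fix i assume "i \<in> jump_set bc v"
    then have i: "i < N" "v $ ?s i \<noteq> v $ i"
      using dim by (auto simp: jump_set_def fwd_diff_index)
    \<comment> \<open>Equal data would give both inequalities of \<open>jump\<close>, hence no jump
      of \<open>v\<close>.\<close>
    then have "f $ i \<noteq> f $ ?s i" using jump[of i "?s i"] by auto
    then show "i \<in> jump_set bc (indicator_vec N \<Omega>)"
      using i succ_index_less[of i N bc]
      by (auto simp: f_def jump_set_def fwd_diff_index indicator_vec_def)
  qed
  then show ?thesis
    using c jump next_index_succ_index unfolding f_def[symmetric] by blast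
qed

end
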